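(* Suppose $W=\sum_{i=1}^n\gamma_i x^{v_i}$ is a complete, positive Laurent polynomial over $\mathbf K$ in $r$ variables, with tropical critical point $d_{\mathrm{crit}}\in\mathbb R^r$. Then $\operatorname{Trop}(W)(d_{\mathrm{crit}})$ is the maximal value of $\operatorname{Trop}(W)$ on $\mathbb R^r$. In particular, whenever $\mathcal P_W=\{d\in\mathbb R^r\mid \operatorname{Trop}(W)(d)\ge 0\}$ is nonempty, $d_{\mathrm{crit}}$ lies in the relative interior of $\mathcal P_W$.
   Context: $\mathbf K$ is the field of generalised Puiseux series: series $c(t)=\sum_{k} c_{\mu_k}t^{\mu_k}$ with $c_{\mu_k}\in\mathbb C$, where the real exponents $\mu_0<\mu_1<\cdots$ form a strictly increasing sequence that is either finite or tends to $+\infty$. The valuation $\operatorname{Val}_{\mathbf K}$ takes a nonzero series to its lowest exponent with nonzero coefficient ($\operatorname{Val}_{\mathbf K}(0)=\infty$). $\mathbf K_{>0}$ is the set of nonzero series whose leading coefficient is a positive real number. A Laurent polynomial $W=\sum_{i=1}^n\gamma_i x^{v_i}$ in $r$ variables (with distinct $v_i\in\mathbb Z^r$) is positive if all $\gamma_i\in\mathbf K_{>0}$, and complete if its Newton polytope $\operatorname{ConvexHull}(\{v_1,\dots,v_n\})\subset\mathbb R^r$ is $r$-dimensional with $0$ in its interior. A complete, positive $W$ has a unique critical point $p_{\mathrm{crit}}$ in $(\mathbf K_{>0})^r$ (the positive critical point), and $d_{\mathrm{crit}}\in\mathbb R^r$ is defined as the vector of valuations of the coordinates of $p_{\mathrm{crit}}$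 (the tropical critical point). The tropicalisation of $W$ is $\operatorname{Trop}(W)(d)=\min_i\{c_i+\langle v_i,d\rangle\}$, where $c_i=\operatorname{Val}_{\mathbf K}(\gamma_i)$ and $\langle\ ,\ \rangle$ is the standard inner product on $\mathbb R^r$. The set $\mathcal P_W$ is either empty or a convex polytope. *)

theory Defs
  imports "HOL-Analysis.Analysis" "HOL-Library.Poly_Mapping"
begin

section \<open>Generalised Puiseux series\<close>

text \<open>A series is the function sending an exponent to its coefficient.\<close>

definition puiseux_support :: "real set \<Rightarrow> bool" where
  "puiseux_support S \<longleftrightarrow> finite S \<or>
     (\<exists>\<mu> :: nat \<Rightarrow> real. strict_mono \<mu> \<and> filterlim \<mu> at_top sequentially \<and> S = range \<mu>)"

lemma puiseux_support_iff: "puiseux_support S \<longleftrightarrow> (\<forall>b. finite {x \<in> S. x \<le> b})"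
proof
  assume "puiseux_support S"
  then consider "finite S" | \<mu> :: "nat \<Rightarrow> real" where "filterlim \<mu> at_top sequentially" "S = range \<mu>"
    unfolding puiseux_support_def by blast
  then show "\<forall>b. finite {x \<in> S. x \<le> b}"
  proof cases
    case 2
    show ?thesis
    proof
      fix b
      have "eventually (\<lambda>n. \<mu> n > b) sequentially"
        using 2(1) by (auto simp: filterlim_at_top_dense)
      then obtain N where N: "\<And>n. n \<ge> N \<Longrightarrow> \<mu> n > b"
        by (auto simp: eventually_sequentially)
      have "{x \<in> S. x \<le> b} \<subseteq> \<mu> ` {..<N}"
        using N 2(2) by (auto, metis imageI lessThan_iff linorder_not_le)
      then show "finite {x \<in> S. x \<le> b}"
        by (rule finite_subset) simp
    qed
  qed auto
next
  assume fin: "\<forall>b. finite {x \<in> S. x \<le> b}"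
  show "puiseux_support S"
  proof (cases "finite S")
    case False
    have least: "\<exists>y. y \<in> S \<and> Q y \<and> (\<forall>z \<in> S. Q z \<longrightarrow> y \<le> z)" if "x \<in> S" "Q x" for Q x
    proof -
      let ?A = "{z \<in> S. z \<le> x \<and> Q z}"
      have f: "finite ?A"
        by (rule finite_subset[of _ "{z \<in> S. z \<le> x}"]) (use fin in auto)
      have ne: "?A \<noteq> {}" using that by auto
      have "Min ?A \<in> ?A" using f ne by (rule Min_in)
      moreover have "Min ?A \<le> z" if z: "z \<in> S" "Q z" for z
      proof (cases "z \<le> x")
        case True
        with f z show ?thesis by (intro Min_le) auto
      next
        case False
        have "Min ?A \<le> x" using \<open>Min ?A \<in> ?A\<close> by auto
        with False show ?thesis by simp
      qed
      ultimately show ?thesis by blast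
    qed
    have inf: "\<exists>x. x \<in> S \<and> x > a" for a
    proof (rule ccontr)
      assume "\<nexists>x. x \<in> S \<and> x > a"
      then have "S = {x \<in> S. x \<le> a}" by force
      with fin False show False by metis
    qed
    define m where "m = (SOME y. y \<in> S \<and> (\<forall>z \<in> S. y \<le> z))"
    have m: "m \<in> S" "\<And>z. z \<in> S \<Longrightarrow> m \<le> z"
    proof -
      obtain x where "x \<in> S" using inf by blast
      then have "\<exists>y. y \<in> S \<and> (\<forall>z \<in> S. y \<le> z)"
        using least[of x "\<lambda>_. True"] by simp
      then have "m \<in> S \<and> (\<forall>z \<in> S. m \<le> z)"
        unfolding m_def by (rule someI_ex)
      then show "m \<in> S" "\<And>z. z \<in> S \<Longrightarrow> m \<le> z" by auto
    qed
    define s where "s = (\<lambda>a. SOME y. y \<in> S \<and> a < y \<and> (\<forall>z \<in> S. a < z \<longrightarrow> y \<le> z))"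
    have s: "s a \<in> S" "a < s a" "\<And>z. z \<in> S \<Longrightarrow> a < z \<Longrightarrow> s a \<le> z" for a
    proof -
      obtain x where "x \<in> S" "a < x" using inf by blast
      then have "\<exists>y. y \<in> S \<and> a < y \<and> (\<forall>z \<in> S. a < z \<longrightarrow> y \<le> z)"
        using least[of x "\<lambda>y. a < y"] by simp
      then have "s a \<in> S \<and> a < s a \<and> (\<forall>z \<in> S. a < z \<longrightarrow> s a \<le> z)"
        unfolding s_def by (rule someI_ex)
      then show "s a \<in> S" "a < s a" "\<And>z. z \<in> S \<Longrightarrow> a < z \<Longrightarrow> s a \<le> z" by auto
    qed
    define \<mu> where "\<mu> = rec_nat m (\<lambda>_. s)"
    have \<mu>0: "\<mu> 0 = m" and \<mu>S: "\<mu> (Suc n) = s (\<mu> n)" for n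
      by (simp_all add: \<mu>_def)
    have mono: "strict_mono \<mu>"
      unfolding strict_mono_Suc_iff by (simp add: \<mu>S s(2))
    have sub: "\<mu> n \<in> S" for n
      by (cases n) (simp_all add: \<mu>0 \<mu>S m(1) s(1))
    have unb: "\<exists>n. \<mu> n > b" for b
    proof (rule ccontr)
      assume "\<nexists>n. \<mu> n > b"
      then have "range \<mu> \<subseteq> {x \<in> S. x \<le> b}" using sub by (auto simp: not_less)
      then have "finite (range \<mu>)" using fin finite_subset by blast
      moreover have "inj \<mu>" using mono by (rule strict_mono_imp_inj_on)
      ultimately show False using finite_imageD by blast
    qed
    have lim: "filterlim \<mu> at_top sequentially"
      unfolding filterlim_at_top_dense eventually_sequentially
    proof
      fix b
      obtain N where "\<mu> N > b" using unb by blast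
      then have "\<forall>n\<ge>N. b < \<mu> n"
        using mono by (meson less_le_trans strict_mono_less_eq)
      then show "\<exists>N. \<forall>n\<ge>N. b < \<mu> n" ..
    qed
    have "S \<subseteq> range \<mu>"
    proof (rule subsetI, rule ccontr)
      fix x assume x: "x \<in> S" "x \<notin> range \<mu>"
      have "\<mu> n < x" for n
      proof (induction n)
        case 0
        have "m \<le> x" using x m by auto
        then show ?case using x(2) \<mu>0 by (metis order_le_less rangeI)
      next
        case (Suc n)
        have "\<mu> (Suc n) \<le> x" using s(3)[OF x(1) Suc] by (simp add: \<mu>S)
        then show ?case using x(2) by (metis order_le_less rangeI)
      qed
      with unb show False using less_asym by blast
    qed
    then have "S = range \<mu>" using sub by blast
    with mono lim show ?thesis unfolding puiseux_support_def by blast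
  qed (simp add: puiseux_support_def)
qed

typedef puiseux = "{f :: real \<Rightarrow> complex. puiseux_support {x. f x \<noteq> 0}}"
  morphisms coeff Abs_puiseux
proof
  show "(\<lambda>_. 0) \<in> {f :: real \<Rightarrow> complex. puiseux_support {x. f x \<noteq> 0}}"
    by (simp add: puiseux_support_def)
qed

lemma puiseux_eqI: "(\<And>x. coeff f x = coeff g x) \<Longrightarrow> f = g"
  by (metis coeff_inject ext)

lemma finite_coeff_le: "finite {x. coeff f x \<noteq> 0 \<and> x \<le> b}"
  using coeff[of f] unfolding mem_Collect_eq puiseux_support_iff by (rule spec)

lemma coeff_Abs:
  assumes "\<And>b. finite {x. f x \<noteq> 0 \<and> x \<le> b}"
  shows "coeff (Abs_puiseux f) = f"
proof (rule Abs_puiseux_inverse)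
  show "f \<in> {f. puiseux_support {x. f x \<noteq> 0}}"
    unfolding mem_Collect_eq puiseux_support_iff by (intro allI assms)
qed

lemma ex_least_exponent:
  assumes "f \<noteq> (\<lambda>_. 0 :: complex)" "\<And>b. finite {x::real. f x \<noteq> 0 \<and> x \<le> b}"
  shows "\<exists>m. f m \<noteq> 0 \<and> (\<forall>x. f x \<noteq> 0 \<longrightarrow> m \<le> x)"
proof -
  obtain b where b: "f b \<noteq> 0" using assms(1) by auto
  let ?A = "{x. f x \<noteq> 0 \<and> x \<le> b}"
  have fin: "finite ?A" by (rule assms(2))
  have ne: "?A \<noteq> {}" using b by blast
  have "Min ?A \<in> ?A" using fin ne by (rule Min_in)
  moreover have "Min ?A \<le> x" if "f x \<noteq> 0" for x
  proof (cases "x \<le> b")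
    case True
    then have "x \<in> ?A" using that by simp
    with fin show ?thesis by (rule Min_le)
  next
    case False
    moreover have "Min ?A \<le> b" using \<open>Min ?A \<in> ?A\<close> by auto
    ultimately show ?thesis by simp
  qed
  ultimately show ?thesis by blast
qed

instantiation puiseux :: "{zero, one, plus, minus, uminus, times}"
begin

definition "0 = Abs_puiseux (\<lambda>_. 0)"
definition "1 = Abs_puiseux (\<lambda>x. if x = 0 then 1 else 0)"
definition "f + g = Abs_puiseux (\<lambda>x. coeff f x + coeff g x)"
definition "f - g = Abs_puiseux (\<lambda>x. coeff f x - coeff g x)"
definition "- f = Abs_puiseux (\<lambda>x. - coeff f x)"
definition "f * g = Abs_puiseux (\<lambda>x. \<Sum>a | coeff f a \<noteq> 0 \<and> coeff g (x - a) \<noteq> 0.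
  coeff f a * coeff g (x - a))"

instance ..

end

lemma coeff_0 [simp]: "coeff 0 x = 0"
  unfolding zero_puiseux_def by (subst coeff_Abs) simp_all

lemma coeff_1: "coeff 1 x = (if x = 0 then 1 else 0)"
  unfolding one_puiseux_def
proof (subst coeff_Abs)
  fix b :: real
  show "finite {x. (if x = 0 then 1 else 0 :: complex) \<noteq> 0 \<and> x \<le> b}"
    by (rule finite_subset[of _ "{0}"]) (auto split: if_splits)
qed simp

lemma coeff_add [simp]: "coeff (f + g) x = coeff f x + coeff g x"
  unfolding plus_puiseux_def
proof (subst coeff_Abs)
  fix b show "finite {x. coeff f x + coeff g x \<noteq> 0 \<and> x \<le> b}"
    by (rule finite_subset[OF _ finite_UnI[OF finite_coeff_le[of f b] finite_coeff_le[of g b]]]) auto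
qed simp

lemma coeff_diff [simp]: "coeff (f - g) x = coeff f x - coeff g x"
  unfolding minus_puiseux_def
proof (subst coeff_Abs)
  fix b show "finite {x. coeff f x - coeff g x \<noteq> 0 \<and> x \<le> b}"
    by (rule finite_subset[OF _ finite_UnI[OF finite_coeff_le[of f b] finite_coeff_le[of g b]]]) auto
qed simp

lemma coeff_uminus [simp]: "coeff (- f) x = - coeff f x"
  unfolding uminus_puiseux_def by (subst coeff_Abs) (use finite_coeff_le[of f] in auto)

lemma puiseux_eq_0_iff: "f = 0 \<longleftrightarrow> coeff f = (\<lambda>_. 0)"
proof
  assume "coeff f = (\<lambda>_. 0)"
  then show "f = 0" by (intro puiseux_eqI) simp
qed (simp add: fun_eq_iff)

lemma least_exponent:
  assumes "f \<noteq> 0"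
  obtains m where "coeff f m \<noteq> 0" "\<And>x. coeff f x \<noteq> 0 \<Longrightarrow> m \<le> x"
proof -
  have "coeff f \<noteq> (\<lambda>_. 0)" using assms by (simp add: puiseux_eq_0_iff)
  then have "\<exists>m. coeff f m \<noteq> 0 \<and> (\<forall>x. coeff f x \<noteq> 0 \<longrightarrow> m \<le> x)"
    by (rule ex_least_exponent) (rule finite_coeff_le)
  then show ?thesis using that by blast
qed

lemma coeff_lower_bound: obtains m where "\<And>x. coeff f x \<noteq> 0 \<Longrightarrow> m \<le> x"
proof (cases "f = 0")
  case False
  then show ?thesis using least_exponent that by metis
qed (use that[of 0] in simp)

lemma finite_mult_index: "finite {a. coeff f a \<noteq> 0 \<and> coeff g (x - a) \<noteq> 0}"
proof -
  obtain m where m: "\<And>x. coeff g x \<noteq> 0 \<Longrightarrow> m \<le> x" using coeff_lower_bound[of g] by blast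
  show ?thesis
    by (rule finite_subset[OF _ finite_coeff_le[of f "x - m"]]) (use m in force)
qed

lemma coeff_mult:
  "coeff (f * g) x = (\<Sum>a | coeff f a \<noteq> 0 \<and> coeff g (x - a) \<noteq> 0. coeff f a * coeff g (x - a))"
  unfolding times_puiseux_def
proof (subst coeff_Abs)
  fix b
  let ?h = "\<lambda>x. \<Sum>a | coeff f a \<noteq> 0 \<and> coeff g (x - a) \<noteq> 0. coeff f a * coeff g (x - a)"
  obtain m where m: "\<And>x. coeff f x \<noteq> 0 \<Longrightarrow> m \<le> x" using coeff_lower_bound[of f] by blast
  obtain k where k: "\<And>x. coeff g x \<noteq> 0 \<Longrightarrow> k \<le> x" using coeff_lower_bound[of g] by blast
  let ?S = "(\<lambda>(u, v). u + v) `
    ({x. coeff f x \<noteq> 0 \<and> x \<le> b - k} \<times> {x. coeff g x \<noteq> 0 \<and> x \<le> b - m})"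
  have "{x. ?h x \<noteq> 0 \<and> x \<le> b} \<subseteq> ?S"
  proof
    fix x assume "x \<in> {x. ?h x \<noteq> 0 \<and> x \<le> b}"
    then have h: "?h x \<noteq> 0" "x \<le> b" by auto
    then obtain a where a: "coeff f a \<noteq> 0" "coeff g (x - a) \<noteq> 0"
      by (metis (mono_tags, lifting) mem_Collect_eq sum.neutral)
    have "a \<le> b - k" "x - a \<le> b - m" using m[OF a(1)] k[OF a(2)] h(2) by linarith+
    with a show "x \<in> ?S" by (intro image_eqI[of _ _ "(a, x - a)"]) auto
  qed
  then show "finite {x. ?h x \<noteq> 0 \<and> x \<le> b}"
    by (rule finite_subset) (intro finite_imageI finite_cartesian_product finite_coeff_le)
qed simp

lemma coeff_mult_superset:
  assumes "finite A" "\<And>a. coeff f a \<noteq> 0 \<Longrightarrow> coeff g (x - a) \<noteq> 0 \<Longrightarrow> a \<in> A"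
  shows "coeff (f * g) x = (\<Sum>a\<in>A. coeff f a * coeff g (x - a))"
  unfolding coeff_mult by (rule sum.mono_neutral_left) (use assms in auto)

lemma puiseux_mult_commute: "f * g = g * (f :: puiseux)"
proof (rule puiseux_eqI)
  fix x
  show "coeff (f * g) x = coeff (g * f) x"
    unfolding coeff_mult
    by (rule sum.reindex_bij_witness[of _ "\<lambda>a. x - a" "\<lambda>a. x - a"]) auto
qed

lemma coeff_mult_superset':
  assumes "finite A" "\<And>a. coeff g a \<noteq> 0 \<Longrightarrow> coeff f (x - a) \<noteq> 0 \<Longrightarrow> a \<in> A"
  shows "coeff (f * g) x = (\<Sum>a\<in>A. coeff f (x - a) * coeff g a)"
  using coeff_mult_superset[OF assms] by (simp add: puiseux_mult_commute[of f g] mult.commute)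

lemma coeff_mult_bound:
  assumes "\<And>x. coeff f x \<noteq> 0 \<Longrightarrow> a \<le> x" "\<And>x. coeff g x \<noteq> 0 \<Longrightarrow> b \<le> x" "coeff (f * g) x \<noteq> 0"
  shows "a + b \<le> x"
proof -
  have "{u. coeff f u \<noteq> 0 \<and> coeff g (x - u) \<noteq> 0} \<noteq> {}"
  proof
    assume *: "{u. coeff f u \<noteq> 0 \<and> coeff g (x - u) \<noteq> 0} = {}"
    have "coeff (f * g) x = 0" unfolding coeff_mult * by simp
    with assms(3) show False by contradiction
  qed
  then obtain u where u: "coeff f u \<noteq> 0" "coeff g (x - u) \<noteq> 0" by blast
  show ?thesis using assms(1)[OF u(1)] assms(2)[OF u(2)] by linarith
qed

lemma puiseux_mult_assoc: "(f * g) * h = f * (g * (h :: puiseux))"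
proof (rule puiseux_eqI)
  fix x
  obtain mf where mf: "\<And>x. coeff f x \<noteq> 0 \<Longrightarrow> mf \<le> x" using coeff_lower_bound[of f] by blast
  obtain mg where mg: "\<And>x. coeff g x \<noteq> 0 \<Longrightarrow> mg \<le> x" using coeff_lower_bound[of g] by blast
  obtain mh where mh: "\<And>x. coeff h x \<noteq> 0 \<Longrightarrow> mh \<le> x" using coeff_lower_bound[of h] by blast
  have bnd: "mf + mg \<le> y" if "coeff (f * g) y \<noteq> 0" for y
    by (rule coeff_mult_bound[of f mf g mg]) (rule mf mg that, assumption?)+
  have bnd': "mg + mh \<le> y" if "coeff (g * h) y \<noteq> 0" for y
    by (rule coeff_mult_bound[of g mg h mh]) (rule mg mh that, assumption?)+
  define F where "F = {a. coeff f a \<noteq> 0 \<and> a \<le> x - mg - mh}"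
  define H where "H = {a. coeff h a \<noteq> 0 \<and> a \<le> x - mf - mg}"
  have fin: "finite F" "finite H" by (simp_all add: F_def H_def finite_coeff_le)
  have "coeff (f * g * h) x = (\<Sum>c\<in>H. coeff (f * g) (x - c) * coeff h c)"
  proof (rule coeff_mult_superset'[OF fin(2)])
    fix a assume a: "coeff h a \<noteq> 0" "coeff (f * g) (x - a) \<noteq> 0"
    then show "a \<in> H" using bnd[OF a(2)] by (simp add: H_def)
  qed
  also have "\<dots> = (\<Sum>c\<in>H. (\<Sum>a\<in>F. coeff f a * coeff g (x - c - a)) * coeff h c)"
  proof (rule sum.cong[OF refl])
    fix c assume "c \<in> H"
    then have c: "mh \<le> c" using mh by (auto simp: H_def)
    have "coeff (f * g) (x - c) = (\<Sum>a\<in>F. coeff f a * coeff g (x - c - a))"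
    proof (intro coeff_mult_superset[OF fin(1)])
      fix a assume a: "coeff f a \<noteq> 0" "coeff g (x - c - a) \<noteq> 0"
      then show "a \<in> F" using c mg[OF a(2)] by (simp add: F_def)
    qed
    then show "coeff (f * g) (x - c) * coeff h c
        = (\<Sum>a\<in>F. coeff f a * coeff g (x - c - a)) * coeff h c" by simp
  qed
  also have "\<dots> = (\<Sum>a\<in>F. coeff f a * (\<Sum>c\<in>H. coeff g (x - a - c) * coeff h c))"
  proof -
    have "(\<Sum>c\<in>H. (\<Sum>a\<in>F. coeff f a * coeff g (x - c - a)) * coeff h c)
        = (\<Sum>c\<in>H. \<Sum>a\<in>F. coeff f a * (coeff g (x - a - c) * coeff h c))"
      unfolding sum_distrib_right by (intro sum.cong refl) (simp add: mult.assoc diff_diff_eq add.commute)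
    also have "\<dots> = (\<Sum>a\<in>F. \<Sum>c\<in>H. coeff f a * (coeff g (x - a - c) * coeff h c))"
      by (rule sum.swap)
    finally show ?thesis unfolding sum_distrib_left .
  qed
  also have "\<dots> = (\<Sum>a\<in>F. coeff f a * coeff (g * h) (x - a))"
  proof (rule sum.cong[OF refl])
    fix a assume "a \<in> F"
    then have c: "mf \<le> a" using mf by (auto simp: F_def)
    have "coeff (g * h) (x - a) = (\<Sum>c\<in>H. coeff g (x - a - c) * coeff h c)"
    proof (intro coeff_mult_superset'[OF fin(2)])
      fix c assume a: "coeff h c \<noteq> 0" "coeff g (x - a - c) \<noteq> 0"
      then show "c \<in> H" using c mg[OF a(2)] by (simp add: H_def)
    qed
    then show "coeff f a * (\<Sum>c\<in>H. coeff g (x - a - c) * coeff h c)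
        = coeff f a * coeff (g * h) (x - a)" by simp
  qed
  also have "\<dots> = coeff (f * (g * h)) x"
  proof (rule coeff_mult_superset[OF fin(1), symmetric])
    fix a assume a: "coeff f a \<noteq> 0" "coeff (g * h) (x - a) \<noteq> 0"
    then show "a \<in> F" using bnd'[OF a(2)] by (simp add: F_def)
  qed
  finally show "coeff (f * g * h) x = coeff (f * (g * h)) x" .
qed

instance puiseux :: comm_ring_1
proof
  fix a b c :: puiseux
  show "a * b * c = a * (b * c)" by (rule puiseux_mult_assoc)
  show "a * b = b * a" by (rule puiseux_mult_commute)
  show "1 * a = a"
  proof (rule puiseux_eqI)
    fix x
    show "coeff (1 * a) x = coeff a x"
      by (subst coeff_mult_superset[of "{0}"]) (auto simp: coeff_1 split: if_splits)
  qed
  show "(a + b) * c = a * c + b * c"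
  proof (rule puiseux_eqI)
    fix x
    let ?A = "{u. coeff a u \<noteq> 0 \<and> coeff c (x - u) \<noteq> 0} \<union> {u. coeff b u \<noteq> 0 \<and> coeff c (x - u) \<noteq> 0}"
    have f: "finite ?A" by (simp add: finite_mult_index)
    have "coeff ((a + b) * c) x = (\<Sum>u\<in>?A. coeff (a + b) u * coeff c (x - u))"
      by (rule coeff_mult_superset[OF f]) auto
    moreover have "coeff (a * c) x = (\<Sum>u\<in>?A. coeff a u * coeff c (x - u))"
      by (rule coeff_mult_superset[OF f]) auto
    moreover have "coeff (b * c) x = (\<Sum>u\<in>?A. coeff b u * coeff c (x - u))"
      by (rule coeff_mult_superset[OF f]) auto
    ultimately show "coeff ((a + b) * c) x = coeff (a * c + b * c) x"
      by (simp add: distrib_right sum.distrib)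
  qed
  show "(0::puiseux) \<noteq> 1"
    by (metis coeff_0 coeff_1 zero_neq_one)
qed (auto intro!: puiseux_eqI simp: algebra_simps)

definition puiseux_monom :: "complex \<Rightarrow> real \<Rightarrow> puiseux" where
  "puiseux_monom c m = Abs_puiseux (\<lambda>x. if x = m then c else 0)"

lemma coeff_monom: "coeff (puiseux_monom c m) x = (if x = m then c else 0)"
  unfolding puiseux_monom_def
proof (subst coeff_Abs)
  fix b :: real
  show "finite {x. (if x = m then c else 0) \<noteq> 0 \<and> x \<le> b}"
    by (rule finite_subset[of _ "{m}"]) (auto split: if_splits)
qed simp

lemma coeff_monom_mult: "coeff (puiseux_monom c m * f) x = c * coeff f (x - m)"
  by (subst coeff_mult_superset[of "{m}"]) (auto simp: coeff_monom split: if_splits)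

lemma coeff_power_bound:
  assumes "\<And>x. coeff u x \<noteq> 0 \<Longrightarrow> a \<le> x" "coeff (u ^ n) x \<noteq> 0"
  shows "real n * a \<le> x"
  using assms(2)
proof (induction n arbitrary: x)
  case 0
  then show ?case by (auto simp: coeff_1 split: if_splits)
next
  case (Suc n)
  have "a + real n * a \<le> x"
    by (rule coeff_mult_bound[of u a "u ^ n"]) (use assms(1) Suc in auto)
  then show ?case by (simp add: algebra_simps)
qed

lemma coeff_sum: "coeff (sum F A) x = (\<Sum>i\<in>A. coeff (F i) x)"
  by (induction A rule: infinite_finite_induct) auto

lemma puiseux_geometric_inverse:
  assumes "a > 0" "\<And>x. coeff u x \<noteq> 0 \<Longrightarrow> a \<le> x"
  shows "\<exists>g. (1 - u) * g = 1"
proof -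
  define N where "N = (\<lambda>b::real. Suc (nat \<lfloor>b / a\<rfloor>))"
  have N: "b < real n * a" if "n \<ge> N b" for n b
  proof -
    have "b / a < real n" using that unfolding N_def by linarith
    then show ?thesis using assms(1) by (simp add: field_simps)
  qed
  have pw: "coeff (u ^ i) x = 0" if "i \<ge> N x" for i x
  proof (rule ccontr)
    assume "coeff (u ^ i) x \<noteq> 0"
    then have "real i * a \<le> x"
      by (rule coeff_power_bound[rotated]) (rule assms(2))
    with N[OF that] show False by simp
  qed
  define S where "S = (\<lambda>n. \<Sum>i<n. u ^ i)"
  have Sconst: "coeff (S n) x = coeff (S k) x" if "n \<ge> k" "k \<ge> N x" for n k x
  proof -
    show ?thesis
      unfolding S_def coeff_sum
    proof (intro sum.mono_neutral_right ballI)
      fix i assume "i \<in> {..<n} - {..<k}"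
      then have "N x \<le> i" using that by simp
      then show "coeff (u ^ i) x = 0" by (rule pw)
    qed (use that in auto)
  qed
  have Nmono: "N x \<le> N y" if "x \<le> y" for x y
    unfolding N_def using that assms(1)
    by (simp add: nat_mono floor_mono divide_right_mono)
  define g where "g = Abs_puiseux (\<lambda>x. coeff (S (N x)) x)"
  have g: "coeff g = (\<lambda>x. coeff (S (N x)) x)"
    unfolding g_def
  proof (rule coeff_Abs)
    fix b
    have "{x. coeff (S (N x)) x \<noteq> 0 \<and> x \<le> b} \<subseteq> {x. coeff (S (N b)) x \<noteq> 0 \<and> x \<le> b}"
    proof (clarsimp)
      fix x assume "coeff (S (N x)) x \<noteq> 0" "x \<le> b" "coeff (S (N b)) x = 0"
      then show False using Sconst[OF Nmono[OF \<open>x \<le> b\<close>] order_refl] by simp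
    qed
    then show "finite {x. coeff (S (N x)) x \<noteq> 0 \<and> x \<le> b}"
      by (rule finite_subset) (rule finite_coeff_le)
  qed
  have u0: "x \<ge> 0" if "coeff (1 - u) x \<noteq> 0" for x
    using that assms(1) assms(2)[of x] by (auto simp: coeff_1 split: if_splits)
  have "(1 - u) * g = 1"
  proof (rule puiseux_eqI)
    fix x
    have eq: "coeff g (x - y) = coeff (S (N x)) (x - y)" if "y \<ge> 0" for y
      using Sconst[of "N (x - y)" "N x" "x - y"] Nmono[of "x - y" x] that g by simp
    have "coeff ((1 - u) * g) x = coeff ((1 - u) * S (N x)) x"
      unfolding coeff_mult
    proof (rule sum.cong)
      have *: "coeff (1 - u) a = 0 \<or> coeff g (x - a) = coeff (S (N x)) (x - a)" for a
        using u0 eq by blast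
      then show "{a. coeff (1 - u) a \<noteq> 0 \<and> coeff g (x - a) \<noteq> 0}
          = {a. coeff (1 - u) a \<noteq> 0 \<and> coeff (S (N x)) (x - a) \<noteq> 0}"
        by (intro Collect_cong) metis
      fix a
      assume "a \<in> {a. coeff (1 - u) a \<noteq> 0 \<and> coeff (S (N x)) (x - a) \<noteq> 0}"
      then show "coeff (1 - u) a * coeff g (x - a) = coeff (1 - u) a * coeff (S (N x)) (x - a)"
        using *[of a] by auto
    qed
    also have "(1 - u) * S (N x) = 1 - u ^ N x"
      unfolding S_def by (simp add: one_diff_power_eq)
    also have "coeff (1 - u ^ N x) x = coeff 1 x"
      by (simp add: pw)
    finally show "coeff ((1 - u) * g) x = coeff 1 x" .
  qed
  then show ?thesis ..
qed

lemma puiseux_inverse_exists: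
  assumes "f \<noteq> (0 :: puiseux)"
  shows "\<exists>g. f * g = 1"
proof -
  obtain m where m: "coeff f m \<noteq> 0" "\<And>x. coeff f x \<noteq> 0 \<Longrightarrow> m \<le> x"
    using least_exponent[OF assms] by blast
  define k where "k = puiseux_monom (inverse (coeff f m)) (- m)"
  define u where "u = 1 - k * f"
  have cu: "coeff u x = (if x = 0 then 1 else 0) - inverse (coeff f m) * coeff f (x + m)" for x
    by (simp add: u_def k_def coeff_1 coeff_monom_mult)
  have pos: "x > 0" if "coeff u x \<noteq> 0" for x
  proof -
    have "x \<noteq> 0" using that m(1) by (auto simp: cu)
    then have "coeff f (x + m) \<noteq> 0" using that by (auto simp: cu)
    then have "m \<le> x + m" by (rule m(2))
    with \<open>x \<noteq> 0\<close> show ?thesis by simp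
  qed
  have "\<exists>a>0. \<forall>x. coeff u x \<noteq> 0 \<longrightarrow> a \<le> x"
  proof (cases "u = 0")
    case False
    then obtain a where "coeff u a \<noteq> 0" "\<And>x. coeff u x \<noteq> 0 \<Longrightarrow> a \<le> x"
      using least_exponent by blast
    then show ?thesis using pos by blast
  next
    case True
    then show ?thesis by (intro exI[of _ 1]) simp
  qed
  then obtain g where "(1 - u) * g = 1" using puiseux_geometric_inverse by blast
  then have "k * f * g = 1" by (simp add: u_def)
  then have "f * (k * g) = 1" by (simp only: mult_ac)
  then show ?thesis ..
qed

instantiation puiseux :: inverse
begin

definition inverse_puiseux_def:
  "inverse (f :: puiseux) = (if f = 0 then 0 else THE g. f * g = 1)"

definition divide_puiseux_def:
  "(f :: puiseux) div g = f * inverse g"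

instance ..

end

instance puiseux :: field
proof
  fix f g :: puiseux
  show "inverse f * f = 1" if "f \<noteq> 0"
  proof -
    obtain g where g: "f * g = 1" using puiseux_inverse_exists[OF \<open>f \<noteq> 0\<close>] by blast
    have "h = g" if "f * h = 1" for h
    proof -
      have "h = h * (f * g)" by (simp add: g)
      also have "\<dots> = (f * h) * g" by (simp add: mult_ac)
      finally show ?thesis by (simp add: that)
    qed
    with g have "f * (THE g. f * g = 1) = 1" by (rule theI)
    then show ?thesis using that by (simp add: inverse_puiseux_def mult.commute)
  qed
  show "f div g = f * inverse g" by (simp add: divide_puiseux_def)
  show "inverse (0 :: puiseux) = 0" by (simp add: inverse_puiseux_def)
qed

definition least_exp :: "puiseux \<Rightarrow> real" where
  "least_exp c = (LEAST \<mu>. coeff c \<mu> \<noteq> 0)"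

definition Val :: "puiseux \<Rightarrow> ereal" where
  "Val c = (if c = 0 then \<infinity> else ereal (least_exp c))"

definition puiseux_pos :: "puiseux set" where
  "puiseux_pos = {c. c \<noteq> 0 \<and> (\<exists>a::real. a > 0 \<and> coeff c (least_exp c) = complex_of_real a)}"

lemma least_exp:
  assumes "c \<noteq> 0"
  shows "coeff c (least_exp c) \<noteq> 0" "coeff c \<mu> \<noteq> 0 \<Longrightarrow> least_exp c \<le> \<mu>"
proof -
  obtain m where m: "coeff c m \<noteq> 0" "\<And>x. coeff c x \<noteq> 0 \<Longrightarrow> m \<le> x"
    using least_exponent[OF assms] by blast
  have "least_exp c = m" unfolding least_exp_def using m by (rule Least_equality)
  with m show "coeff c (least_exp c) \<noteq> 0" "coeff c \<mu> \<noteq> 0 \<Longrightarrow> least_exp c \<le> \<mu>" by auto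
qed


section \<open>Laurent polynomials\<close>

text \<open>
  The Laurent polynomial \<open>\<Sum>\<^sub>i \<gamma>\<^sub>i x\<^bsup>v\<^sub>i\<^esup>\<close> with distinct exponents and nonzero coefficients is the
  finitely supported map \<open>v\<^sub>i \<mapsto> \<gamma>\<^sub>i\<close>; its exponents are \<open>Poly_Mapping.keys\<close> and its
  coefficients \<open>Poly_Mapping.lookup\<close>. The number of variables \<open>r\<close> is \<open>CARD('r)\<close>.
\<close>

type_synonym 'r laurent = "(int ^ 'r) \<Rightarrow>\<^sub>0 puiseux"

definition exponent_vec :: "int ^ 'r \<Rightarrow> real ^ 'r" where
  "exponent_vec v = (\<chi> i. of_int (v $ i))"

definition eval_laurent :: "'r::finite laurent \<Rightarrow> puiseux ^ 'r \<Rightarrow> puiseux" where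
  "eval_laurent W p =
     (\<Sum>v \<in> Poly_Mapping.keys W. Poly_Mapping.lookup W v * (\<Prod>i\<in>UNIV. (p $ i) powi (v $ i)))"

definition partial_deriv :: "'r::finite \<Rightarrow> 'r laurent \<Rightarrow> 'r laurent" where
  "partial_deriv j W =
     (\<Sum>v \<in> Poly_Mapping.keys W.
        Poly_Mapping.single (v - axis j 1) (of_int (v $ j) * Poly_Mapping.lookup W v))"

definition positive_laurent :: "'r::finite laurent \<Rightarrow> bool" where
  "positive_laurent W \<longleftrightarrow> (\<forall>v \<in> Poly_Mapping.keys W. Poly_Mapping.lookup W v \<in> puiseux_pos)"

definition newton_polytope :: "'r::finite laurent \<Rightarrow> (real ^ 'r) set" where
  "newton_polytope W = convex hull (exponent_vec ` Poly_Mapping.keys W)"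

definition complete_laurent :: "'r::finite laurent \<Rightarrow> bool" where
  "complete_laurent W \<longleftrightarrow>
     aff_dim (newton_polytope W) = int CARD('r) \<and> 0 \<in> interior (newton_polytope W)"

definition positive_critical_point :: "'r::finite laurent \<Rightarrow> puiseux ^ 'r \<Rightarrow> bool" where
  "positive_critical_point W p \<longleftrightarrow>
     (\<forall>i. p $ i \<in> puiseux_pos) \<and> (\<forall>j. eval_laurent (partial_deriv j W) p = 0)"

text \<open>
  For complete positive \<open>W\<close> there is exactly one positive critical point, hence exactly one \<open>d\<close>
  with the following property. Both notions are kept as relations so that they make sense
  independently of that theorem.
\<close>

definition tropical_critical_point :: "'r::finite laurent \<Rightarrow> real ^ 'r \<Rightarrow> bool" where
  "tropical_critical_point W d \<longleftrightarrow>
     (\<exists>p. positive_critical_point W p \<and> (\<forall>i. Val (p $ i) = ereal (d $ i)))"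

text \<open>\<open>Trop\<close> and \<open>trop_polytope\<close> are meaningful only for \<open>W \<noteq> 0\<close>, which completeness guarantees.\<close>

definition Trop :: "'r::finite laurent \<Rightarrow> real ^ 'r \<Rightarrow> ereal" where
  "Trop W d =
     (MIN v \<in> Poly_Mapping.keys W. Val (Poly_Mapping.lookup W v) + ereal (exponent_vec v \<bullet> d))"

definition trop_polytope :: "'r::finite laurent \<Rightarrow> (real ^ 'r) set" where
  "trop_polytope W = {d. Trop W d \<ge> 0}"

end

(* The logarithmic derivatives of W vanish at the positive critical point p, that is,
   the terms g_v of W at p satisfy sum_v v g_v = 0. The leading coefficients of the g_v are
   positive, so the terms of minimal valuation cannot cancel among themselves: comparing
   coefficients at the exponent Trop W d_crit gives a relation sum_v a_v v = 0 with all a_v > 0,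
   where v ranges over the exponents attaining the minimum. Hence no direction pairs positively
   with all of these v, which is maximality; and a direction pairing nonnegatively with all of
   them is orthogonal to all of them, so near d_crit the polytope is an open subset of an
   affine subspace. *)
theory Submission
  imports Defs
begin

section \<open>Leading exponents and positivity in the field of Puiseux series\<close>

lemma least_exp_eqI:
  assumes "coeff f m \<noteq> 0" "\<And>x. coeff f x \<noteq> 0 \<Longrightarrow> m \<le> x"
  shows "least_exp f = m"
  unfolding least_exp_def using assms by (rule Least_equality)

text \<open>In the convolution only one splitting of the exponent survives: any other puts one of
  the two factors below its least exponent.\<close>

lemma coeff_mult_least_exp:
  assumes "f \<noteq> 0" "g \<noteq> 0"
  shows "coeff (f * g) (least_exp f + least_exp g) =
         coeff f (least_exp f) * coeff g (least_exp g)"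
proof -
  have "coeff (f * g) (least_exp f + least_exp g) =
        (\<Sum>a\<in>{least_exp f}. coeff f a * coeff g (least_exp f + least_exp g - a))"
  proof (rule coeff_mult_superset)
    fix a assume "coeff f a \<noteq> 0" "coeff g (least_exp f + least_exp g - a) \<noteq> 0"
    then show "a \<in> {least_exp f}"
      using least_exp(2)[OF assms(1), of a]
        least_exp(2)[OF assms(2), of "least_exp f + least_exp g - a"] by simp
  qed simp
  then show ?thesis by simp
qed

lemma least_exp_mult:
  assumes "f \<noteq> 0" "g \<noteq> 0"
  shows "least_exp (f * g) = least_exp f + least_exp g"
proof (rule least_exp_eqI)
  show "coeff (f * g) (least_exp f + least_exp g) \<noteq> 0"
    using least_exp(1) assms by (simp add: coeff_mult_least_exp)
  show "least_exp f + least_exp g \<le> x" if "coeff (f * g) x \<noteq> 0" for x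
    using least_exp(2)[OF assms(1)] least_exp(2)[OF assms(2)] that by (rule coeff_mult_bound)
qed

lemma least_exp_1: "least_exp 1 = 0"
  by (rule least_exp_eqI) (auto simp: coeff_1 split: if_splits)

lemma puiseux_pos_1: "1 \<in> puiseux_pos"
  by (auto simp: puiseux_pos_def least_exp_1 coeff_1 intro: exI[of _ 1])

lemma puiseux_pos_nonzero: "f \<in> puiseux_pos \<Longrightarrow> f \<noteq> 0"
  by (simp add: puiseux_pos_def)

lemma puiseux_pos_mult:
  assumes "f \<in> puiseux_pos" "g \<in> puiseux_pos"
  shows "f * g \<in> puiseux_pos"
proof -
  obtain a b :: real where "f \<noteq> 0" "g \<noteq> 0" "a > 0" "b > 0"
    "coeff f (least_exp f) = of_real a" "coeff g (least_exp g) = of_real b"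
    using assms by (auto simp: puiseux_pos_def)
  then have "a * b > 0" "f * g \<noteq> 0" "coeff (f * g) (least_exp (f * g)) = of_real (a * b)"
    by (simp_all add: least_exp_mult coeff_mult_least_exp)
  then show ?thesis unfolding puiseux_pos_def by blast
qed

lemma least_exp_inverse:
  assumes "f \<noteq> 0"
  shows "least_exp (inverse f) = - least_exp f"
  using least_exp_mult[of f "inverse f"] assms by (simp add: least_exp_1)

lemma puiseux_pos_inverse:
  assumes "f \<in> puiseux_pos"
  shows "inverse f \<in> puiseux_pos"
proof -
  obtain a :: real where a: "f \<noteq> 0" "a > 0" "coeff f (least_exp f) = of_real a"
    using assms by (auto simp: puiseux_pos_def)
  \<comment> \<open>The two least exponents add up to 0, where the product 1 has coefficient
    1.\<close>
  then have "of_real a * coeff (inverse f) (least_exp (inverse f)) = 1"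
    using coeff_mult_least_exp[of f "inverse f"] by (simp add: least_exp_inverse coeff_1)
  then have "coeff (inverse f) (least_exp (inverse f)) = of_real (inverse a)"
    using a(2) by (simp add: field_simps)
  moreover have "inverse a > 0" "inverse f \<noteq> 0" using a by simp_all
  ultimately show ?thesis unfolding puiseux_pos_def by blast
qed

lemma puiseux_pos_power: "f \<in> puiseux_pos \<Longrightarrow> f ^ n \<in> puiseux_pos"
  by (induction n) (simp_all add: puiseux_pos_1 puiseux_pos_mult)

lemma least_exp_power: "f \<noteq> 0 \<Longrightarrow> least_exp (f ^ n) = real n * least_exp f"
  by (induction n) (simp_all add: least_exp_1 least_exp_mult algebra_simps)

lemma puiseux_pos_power_int: "f \<in> puiseux_pos \<Longrightarrow> f powi k \<in> puiseux_pos"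
  by (simp add: power_int_def puiseux_pos_power puiseux_pos_inverse)

lemma least_exp_power_int: "f \<noteq> 0 \<Longrightarrow> least_exp (f powi k) = of_int k * least_exp f"
  by (simp add: power_int_def least_exp_power least_exp_inverse)

lemma puiseux_pos_prod: "(\<And>i. i \<in> A \<Longrightarrow> F i \<in> puiseux_pos) \<Longrightarrow> prod F A \<in> puiseux_pos"
  by (induction A rule: infinite_finite_induct) (simp_all add: puiseux_pos_1 puiseux_pos_mult)

lemma least_exp_prod:
  "(\<And>i. i \<in> A \<Longrightarrow> F i \<noteq> 0) \<Longrightarrow> least_exp (prod F A) = (\<Sum>i\<in>A. least_exp (F i))"
  by (induction A rule: infinite_finite_induct) (simp_all add: least_exp_1 least_exp_mult)

lemma coeff_of_int_mult: "coeff (of_int k * f) x = of_int k * coeff f x"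
  by (induction k rule: int_induct[where k = 0]) (simp_all add: algebra_simps)

section \<open>Evaluation and logarithmic derivatives of Laurent polynomials\<close>

lemma eval_laurent_superset:
  assumes "finite A" "Poly_Mapping.keys W \<subseteq> A"
  shows "eval_laurent W p =
         (\<Sum>v\<in>A. Poly_Mapping.lookup W v * (\<Prod>i\<in>UNIV. (p $ i) powi (v $ i)))"
  unfolding eval_laurent_def
  using assms by (intro sum.mono_neutral_left) (auto simp: in_keys_iff)

lemma eval_laurent_0: "eval_laurent 0 p = 0"
  by (simp add: eval_laurent_def)

lemma eval_laurent_add: "eval_laurent (V + W) p = eval_laurent V p + eval_laurent W p"
proof -
  let ?A = "Poly_Mapping.keys V \<union> Poly_Mapping.keys W"
  have "Poly_Mapping.keys (V + W) \<subseteq> ?A" by (rule keys_add)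
  then show ?thesis
    by (simp add: eval_laurent_superset[of ?A] lookup_add distrib_right sum.distrib)
qed

lemma eval_laurent_sum: "eval_laurent (sum F A) p = (\<Sum>i\<in>A. eval_laurent (F i) p)"
  by (induction A rule: infinite_finite_induct) (simp_all add: eval_laurent_0 eval_laurent_add)

lemma eval_laurent_single:
  "eval_laurent (Poly_Mapping.single v c) p = c * (\<Prod>i\<in>UNIV. (p $ i) powi (v $ i))"
  by (subst eval_laurent_superset[of "{v}"]) (auto simp: keys_def lookup_single when_def)

text \<open>Multiplying by \<open>p $ j\<close> undoes the exponent shift made by
  \<open>partial_deriv\<close>, so the derivatives in all directions become weighted sums of the
  same terms of \<open>W\<close> at \<open>p\<close>. Nonzero coordinates make the laws for negative
  powers available.\<close>

lemma eval_laurent_log_deriv: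
  assumes "\<And>i. p $ i \<noteq> 0"
  shows "p $ j * eval_laurent (partial_deriv j W) p =
         (\<Sum>v\<in>Poly_Mapping.keys W.
           of_int (v $ j) * (Poly_Mapping.lookup W v * (\<Prod>i\<in>UNIV. (p $ i) powi (v $ i))))"
proof -
  have mon: "p $ j * (\<Prod>i\<in>UNIV. (p $ i) powi ((v - axis j 1) $ i)) =
        (\<Prod>i\<in>UNIV. (p $ i) powi (v $ i))" for v :: "int ^ 'a"
  proof -
    have "(\<Prod>i\<in>UNIV. (p $ i) powi ((v - axis j 1) $ i)) =
          (\<Prod>i\<in>UNIV. (p $ i) powi (v $ i) * (if i = j then inverse (p $ j) else 1))"
      by (rule prod.cong) (auto simp: axis_def power_int_diff assms field_simps)
    also have "\<dots> = (\<Prod>i\<in>UNIV. (p $ i) powi (v $ i)) * inverse (p $ j)"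
      by (simp add: prod.distrib)
    finally show ?thesis using assms[of j] by simp
  qed
  show ?thesis
    unfolding partial_deriv_def eval_laurent_sum eval_laurent_single sum_distrib_left
  proof (rule sum.cong[OF refl])
    show "p $ j * (of_int (v $ j) * Poly_Mapping.lookup W v *
            (\<Prod>i\<in>UNIV. (p $ i) powi ((v - axis j 1) $ i))) =
          of_int (v $ j) * (Poly_Mapping.lookup W v * (\<Prod>i\<in>UNIV. (p $ i) powi (v $ i)))" for v
      by (subst mon[of v, symmetric]) (simp only: mult_ac)
  qed
qed

section \<open>Tropicalisation and the balance of minimal terms\<close>

lemma Val_nonzero: "c \<noteq> 0 \<Longrightarrow> Val c = ereal (least_exp c)"
  by (simp add: Val_def)

lemma Trop_ge_iff:
  assumes "Poly_Mapping.keys W \<noteq> {}"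
  shows "ereal t \<le> Trop W d \<longleftrightarrow>
         (\<forall>v\<in>Poly_Mapping.keys W. t \<le> least_exp (Poly_Mapping.lookup W v) + exponent_vec v \<bullet> d)"
  unfolding Trop_def using assms by (simp add: Val_nonzero in_keys_iff)

lemma Trop_le:
  assumes "v \<in> Poly_Mapping.keys W"
  shows "Trop W d \<le> ereal (least_exp (Poly_Mapping.lookup W v) + exponent_vec v \<bullet> d)"
proof -
  have "Trop W d \<le> Val (Poly_Mapping.lookup W v) + ereal (exponent_vec v \<bullet> d)"
    unfolding Trop_def by (rule Min_le) (use assms in auto)
  then show ?thesis using assms by (simp add: Val_nonzero in_keys_iff)
qed

text \<open>Without exponents the Newton polytope would be empty and could not contain 0 in its
  interior.\<close>

lemma complete_laurent_keys_nonempty: "complete_laurent W \<Longrightarrow> Poly_Mapping.keys W \<noteq> {}"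
  by (auto simp: complete_laurent_def newton_polytope_def)

text \<open>Extracts from the critical point all that the theorem needs; what remains afterwards is
  convex geometry of the exponents.\<close>

lemma tropical_critical_balance:
  fixes W :: "'r::finite laurent"
  assumes ne: "Poly_Mapping.keys W \<noteq> {}" and "positive_laurent W" "tropical_critical_point W d"
  obtains A m a where "A \<subseteq> Poly_Mapping.keys W" "A \<noteq> {}"
    "\<forall>v\<in>A. least_exp (Poly_Mapping.lookup W v) + exponent_vec v \<bullet> d = m"
    "\<forall>v\<in>Poly_Mapping.keys W - A. m < least_exp (Poly_Mapping.lookup W v) + exponent_vec v \<bullet> d"
    "\<forall>v\<in>A. (a v :: real) > 0"
    "(\<Sum>v\<in>A. a v *\<^sub>R exponent_vec v) = 0"
proof -
  let ?K = "Poly_Mapping.keys W"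
  obtain p where p: "\<And>i. p $ i \<in> puiseux_pos" "\<And>j. eval_laurent (partial_deriv j W) p = 0"
    "\<And>i. Val (p $ i) = ereal (d $ i)"
    using assms(3) by (auto simp: tropical_critical_point_def positive_critical_point_def)
  have p0: "p $ i \<noteq> 0" for i using p(1) by (rule puiseux_pos_nonzero)
  have lp: "least_exp (p $ i) = d $ i" for i using p(3)[of i] p0[of i] by (simp add: Val_nonzero)
  \<comment> \<open>\<open>g v\<close> is the term of \<open>W\<close> with exponent
    \<open>v\<close>, evaluated at \<open>p\<close>; \<open>L v\<close> will be its
    valuation.\<close>
  define g where "g = (\<lambda>v. Poly_Mapping.lookup W v * (\<Prod>i\<in>UNIV. (p $ i) powi (v $ i)))"
  define L where "L = (\<lambda>v. least_exp (Poly_Mapping.lookup W v) + exponent_vec v \<bullet> d)"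
  have gpos: "g v \<in> puiseux_pos" if "v \<in> ?K" for v
    unfolding g_def using that assms(2) p(1)
    by (auto simp: positive_laurent_def intro!: puiseux_pos_mult puiseux_pos_prod puiseux_pos_power_int)
  have gL: "least_exp (g v) = L v" if "v \<in> ?K" for v
  proof -
    have "least_exp (\<Prod>i\<in>UNIV. (p $ i) powi (v $ i)) = exponent_vec v \<bullet> d"
      by (simp add: least_exp_prod least_exp_power_int p0 lp exponent_vec_def inner_vec_def)
    then show ?thesis
      using that p0 by (simp add: g_def L_def least_exp_mult in_keys_iff)
  qed
  \<comment> \<open>\<open>A\<close> collects the exponents at which the tropical minimum
    \<open>m\<close> is attained. Taking the real part in \<open>a\<close> loses nothing on
    \<open>A\<close>, since the leading coefficients there are positive reals.\<close>
  define m where "m = Min (L ` ?K)"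
  define A where "A = {v \<in> ?K. L v = m}"
  define a where "a = (\<lambda>v. Re (coeff (g v) m))"
  have mle: "m \<le> L v" if "v \<in> ?K" for v unfolding m_def using that by simp
  have "m \<in> L ` ?K" unfolding m_def using ne by (intro Min_in) auto
  then have A_ne: "A \<noteq> {}" by (auto simp: A_def)
  have apos: "a v > 0 \<and> coeff (g v) m = of_real (a v)" if "v \<in> A" for v
  proof -
    have "v \<in> ?K" "L v = m" using that by (auto simp: A_def)
    then show ?thesis using gpos[of v] gL[of v] by (auto simp: puiseux_pos_def a_def)
  qed
  \<comment> \<open>Outside \<open>A\<close> a term starts strictly above \<open>m\<close>, so it is
    invisible at exponent \<open>m\<close>.\<close>
  have zero: "coeff (g v) m = 0" if "v \<in> ?K - A" for v
  proof (rule ccontr)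
    assume "coeff (g v) m \<noteq> 0"
    moreover have "v \<in> ?K" using that by blast
    ultimately have "L v \<le> m" using least_exp(2)[OF puiseux_pos_nonzero[OF gpos]] gL by fastforce
    then show False using mle[of v] that by (auto simp: A_def)
  qed
  have "(\<Sum>v\<in>A. a v * of_int (v $ j)) = 0" for j
  proof -
    \<comment> \<open>Criticality makes the logarithmic derivative vanish; its coefficient at
      \<open>m\<close> is the \<open>j\<close>-th coordinate of the balance relation.\<close>
    have "0 = coeff (p $ j * eval_laurent (partial_deriv j W) p) m" by (simp add: p(2))
    also have "\<dots> = (\<Sum>v\<in>?K. of_int (v $ j) * coeff (g v) m)"
      unfolding eval_laurent_log_deriv[OF p0] by (simp add: coeff_sum coeff_of_int_mult g_def)
    also have "\<dots> = (\<Sum>v\<in>A. of_int (v $ j) * coeff (g v) m)"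
      by (rule sum.mono_neutral_right) (auto simp: zero A_def)
    also have "\<dots> = of_real (\<Sum>v\<in>A. a v * of_int (v $ j))"
      using apos by (simp add: mult.commute)
    finally show ?thesis by (metis of_real_eq_0_iff)
  qed
  then have "(\<Sum>v\<in>A. a v *\<^sub>R exponent_vec v) = 0"
    by (simp add: vec_eq_iff exponent_vec_def)
  moreover have "m < L v" if "v \<in> ?K - A" for v
    using mle[of v] that by (auto simp: A_def)
  ultimately show ?thesis
    using that[of A m a] A_ne apos unfolding L_def A_def by blast
qed

text \<open>Pairing the balance relation with \<open>x\<close> gives a vanishing sum of nonnegative
  numbers, so each summand is zero, and the positive weights can be cancelled.\<close>

lemma balance_inner:
  fixes e :: "'b \<Rightarrow> 'a::real_inner"
  assumes "finite A" "\<And>v. v \<in> A \<Longrightarrow> a v > 0" "(\<Sum>v\<in>A. a v *\<^sub>R e v) = 0"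
    "\<And>v. v \<in> A \<Longrightarrow> e v \<bullet> x \<ge> 0" "v \<in> A"
  shows "e v \<bullet> x = 0"
proof -
  have "(\<Sum>v\<in>A. a v * (e v \<bullet> x)) = (\<Sum>v\<in>A. a v *\<^sub>R e v) \<bullet> x"
    by (simp add: inner_sum_left)
  also have "\<dots> = 0" by (simp add: assms(3))
  finally have "a v * (e v \<bullet> x) = 0"
    using sum_nonneg_eq_0_iff[of A "\<lambda>v. a v * (e v \<bullet> x)"] assms by (simp add: less_imp_le)
  then show ?thesis using assms(2)[OF assms(5)] by simp
qed

theorem theorem1p2:
  fixes W :: "'r::finite laurent" and d_crit :: "real ^ 'r"
  assumes "complete_laurent W" and "positive_laurent W"
    and "tropical_critical_point W d_crit"
  shows "(\<forall>d. Trop W d \<le> Trop W d_crit) \<and>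
         (trop_polytope W \<noteq> {} \<longrightarrow> d_crit \<in> rel_interior (trop_polytope W))"
proof -
  let ?K = "Poly_Mapping.keys W" and ?P = "trop_polytope W"
  define L where "L v d = least_exp (Poly_Mapping.lookup W v) + exponent_vec v \<bullet> d" for v d
  have ne: "?K \<noteq> {}" using assms(1) by (rule complete_laurent_keys_nonempty)
  obtain A m a where A: "A \<subseteq> ?K" "A \<noteq> {}" "\<forall>v\<in>A. L v d_crit = m"
    "\<forall>v\<in>?K - A. m < L v d_crit" "\<forall>v\<in>A. (a v :: real) > 0"
    "(\<Sum>v\<in>A. a v *\<^sub>R exponent_vec v) = 0"
    using tropical_critical_balance[OF ne assms(2,3), folded L_def] .
  have finA: "finite A" using A(1) finite_keys by (rule finite_subset)
  have Ldiff: "L v d - L v d_crit = exponent_vec v \<bullet> (d - d_crit)" for v d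
    by (simp add: L_def inner_diff_right)
  \<comment> \<open>If no minimal exponent falls below \<open>m\<close> at \<open>d\<close>, the
    direction \<open>d - d_crit\<close> pairs nonnegatively with all of \<open>A\<close>, so balance
    forces every pairing to be zero.\<close>
  have const: "L v d = m" if "v \<in> A" "\<And>u. u \<in> A \<Longrightarrow> m \<le> L u d" for v d
  proof -
    have "exponent_vec v \<bullet> (d - d_crit) = 0"
    proof (rule balance_inner[OF finA bspec[OF A(5)] A(6) _ that(1)])
      fix u assume "u \<in> A"
      then show "exponent_vec u \<bullet> (d - d_crit) \<ge> 0" using that(2) A(3) by (simp flip: Ldiff)
    qed
    then show ?thesis using Ldiff[of v d] A(3) that(1) by simp
  qed
  have crit: "ereal m \<le> Trop W d_crit"
    using A(3,4) by (force simp: Trop_ge_iff[OF ne] L_def)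
  have le: "Trop W d \<le> ereal m" for d
  proof -
    obtain u where u: "u \<in> A" using A(2) by blast
    \<comment> \<open>If all values on \<open>A\<close> exceeded \<open>m\<close>, then
      \<open>const\<close> would make the one at \<open>u\<close> equal to \<open>m\<close>.\<close>
    have "\<exists>v\<in>A. L v d \<le> m"
    proof (rule ccontr)
      assume "\<not> (\<exists>v\<in>A. L v d \<le> m)"
      then have gt: "m < L v d" if "v \<in> A" for v using that by (simp add: not_le)
      then have "L u d = m" by (intro const u) (rule less_imp_le)
      with gt[OF u] show False by simp
    qed
    then obtain v where "v \<in> A" "L v d \<le> m" by blast
    then show ?thesis
      using Trop_le[of v W d] A(1) unfolding L_def by (meson ereal_less_eq(3) order_trans subsetD)
  qed
  have P_iff: "d \<in> ?P \<longleftrightarrow> (\<forall>v\<in>?K. 0 \<le> L v d)" for d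
    using Trop_ge_iff[OF ne, of 0 d] by (simp add: trop_polytope_def L_def flip: zero_ereal_def)
  have "d_crit \<in> rel_interior ?P" if neP: "?P \<noteq> {}"
  proof -
    obtain d where "0 \<le> Trop W d" using neP by (auto simp: trop_polytope_def)
    \<comment> \<open>A point of the polytope has \<open>Trop W d\<close> between 0 and
      \<open>m\<close>; this is how nonemptiness enters.\<close>
    then have m0: "0 \<le> m" using le[of d] by (metis ereal_less_eq(5) order_trans)
    have crit_P: "d_crit \<in> ?P"
      unfolding P_iff using A(3,4) m0 by (metis DiffI less_imp_le order_trans order_refl)
    \<comment> \<open>\<open>N\<close> consists of the constraints that are tight at
      \<open>d_crit\<close>: all of \<open>A\<close> if \<open>m = 0\<close>, and none if
      \<open>m > 0\<close>, in which case \<open>H\<close> is the whole space.\<close>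
    define N where "N = {v \<in> ?K. L v d_crit = 0}"
    define H where "H = {d. \<forall>v\<in>N. L v d = 0}"
    have "?P \<subseteq> H"
    proof (clarsimp simp: H_def)
      fix d v assume d: "d \<in> ?P" and v: "v \<in> N"
      \<comment> \<open>Off \<open>A\<close> the value at \<open>d_crit\<close> exceeds
        \<open>m\<close>, hence is positive, so a tight constraint lies in \<open>A\<close>. Then
        \<open>m = 0\<close>, and membership in the polytope is exactly the premise of
        \<open>const\<close>.\<close>
      then have "v \<in> A" using A(4) m0 by (force simp: N_def)
      moreover from this have "m = 0" using v A(3) by (auto simp: N_def)
      ultimately show "L v d = 0" using const[of v d] d A(1) by (auto simp: P_iff)
    qed
    moreover have "affine H"
    proof -
      have "H = (\<Inter>v\<in>N. {d. exponent_vec v \<bullet> d = - least_exp (Poly_Mapping.lookup W v)})"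
        by (auto simp: H_def L_def add_eq_0_iff)
      then show ?thesis by (auto intro: affine_hyperplane)
    qed
    ultimately have hull: "affine hull ?P \<subseteq> H" by (rule hull_minimal)
    \<comment> \<open>\<open>U\<close> is the neighbourhood of \<open>d_crit\<close> on which the
      slack constraints stay strict. Within the affine hull the tight ones hold with equality, so
      nothing else cuts the polytope there.\<close>
    define U where "U = (\<Inter>v\<in>?K - N. {d. 0 < L v d})"
    have "open U"
      unfolding U_def L_def by (intro open_INT) (auto intro!: open_Collect_less continuous_intros)
    moreover have "d_crit \<in> U"
      using crit_P by (auto simp: U_def N_def P_iff order_less_le)
    moreover have "U \<inter> affine hull ?P \<subseteq> ?P"
    proof
      fix d assume "d \<in> U \<inter> affine hull ?P"
      then have "d \<in> U" "d \<in> H" using hull by auto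
      then have "\<forall>v\<in>?K - N. 0 < L v d" "\<forall>v\<in>N. L v d = 0" by (auto simp: U_def H_def)
      then show "d \<in> ?P" unfolding P_iff by (metis DiffI less_imp_le order_refl)
    qed
    ultimately show ?thesis using crit_P by (auto simp: mem_rel_interior)
  qed
  then show ?thesis using le crit by (meson order_trans)
qed

end
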